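(* Let $\mathcal{L}=\langle S, Act_\tau,\to\rangle$ be a finite-branching labelled transition system of processes. Then for every formula $\phi\in\mathrm{mustHML}$ there exists a test $t$ (a closed term of the test language) such that $\phi$ must-represents $t$; that is, for every $p\in S$, $p\ \mathbf{must\ satisfy}\ t$ if and only if $p\in[\![\phi]\!]$.
   Context: **Labelled transition systems.** An LTS over a countable set $Act$ of external actions is a triple $\langle S,Act_\tau,\to\rangle$ with $S$ a countable set of states (processes), $Act_\tau=Act\cup\{\tau\}$ where $\tau\notin Act$, and $\to\subseteq S\times Act_\tau\times S$; write $s\xrightarrow{\alpha}s'$ for $(s,\alpha,s')\in\to$, and $s\xrightarrow{\alpha}$ if such an $s'$ exists. The letter $a$ ranges over $Act$, $\alpha$ over $Act_\tau$. $\mathrm{Succ}(s)=\{s' : s\xrightarrow{\alpha}s'\text{ for some }\alpha\in Act_\tau\}$; the LTS is finite branching if $\mathrm{Succ}(s)$ is finite for all $s\in S$. $s\Uparrow$ (diverges) if there is an infinite path $s\xrightarrow{\tau}s_1\xrightarrow{\tau}\cdots$; otherwise $s\Downarrow$ (converges). Weak transitions: $\stackrel{\tau}{\Rightarrow}$ is the reflexive transitive closure of $\xrightarrow{\tau}$, and $s\stackrel{a}{\Rightarrow}s'$ means $s\stackrel{\tau}{\Rightarrow}s''\xrightarrow{a}s'''\stackrel{\tau}{\Rightarrow}s'$ for some $s'',s'''$; $s\stackrel{\alpha}{\Rightarrow}$ means $s\stackrel{\alpha}{\Rightarrow}s'$ for some $s'$. **The language mustHML.** It is the set of closed formulae generated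 by $\phi ::= \mathtt{tt}\mid\mathtt{ff}\mid \mathrm{Acc}\,A\mid X\mid[\alpha]\phi\mid\phi_1\wedge\phi_2\mid \min(X,\phi)$, where $X$ ranges over a countable set $Var$ of variables, $\alpha\in Act_\tau$, $A$ is a finite subset of $Act$, and $\min(X,\cdot)$ binds $X$. Given an environment $\rho:Var\to 2^S$, formulae are interpreted by: $[\![\mathtt{tt}]\!]\rho=S$; $[\![\mathtt{ff}]\!]\rho=\emptyset$; $[\![X]\!]\rho=\rho(X)$; $[\![\mathrm{Acc}\,A]\!]\rho=\{s : s\Downarrow,\text{ and } s\stackrel{\tau}{\Rightarrow}s'\text{ implies } s'\stackrel{a}{\Rightarrow}\text{ for some }a\in A\}$; $[\![[\alpha]\phi]\!]\rho=\{s : s\Downarrow,\text{ and } s\stackrel{\alpha}{\Rightarrow}s'\text{ implies }s'\in[\![\phi]\!]\rho\}$; $[\![\phi_1\wedge\phi_2]\!]\rho=[\![\phi_1]\!]\rho\cap[\![\phi_2]\!]\rho$; $[\![\min(X,\phi)]\!]\rho=\bigcap\{P\subseteq S : [\![\phi]\!]\rho[X\mapsto P]\subseteq P\}$. For closed $\phi$ the environment is omitted. **Tests.** Let $\omega\notin Act_\tau$. Tests are the closed terms of $t::=0\mid\alpha.t\mid\omega.0\mid X\mid t_1+t_2\mid\mu X.t$ ($\alpha\in Act_\tau$, $\mu X$ binds $X$), with transitions given by the rules: $\alpha.t\xrightarrow{\alpha}t$ for $\alpha\in Act_\tau\cup\{\omega\}$; if $t_i\xrightarrow{\alpha}t'$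 for $i=1$ or $i=2$ then $t_1+t_2\xrightarrow{\alpha}t'$; $\mu X.t\xrightarrow{\tau}t\{\mu X.t/X\}$. **Testing.** For a process $p$ and test $t$, the experiment $p\,|\,t$ has only $\tau$-moves: $p|t\to p'|t$ if $p\xrightarrow{\tau}p'$; $p|t\to p|t'$ if $t\xrightarrow{\tau}t'$; $p|t\to p'|t'$ if $p\xrightarrow{a}p'$ and $t\xrightarrow{a}t'$ for some $a\in Act$. A computation of $p|t$ is a maximal (finite or infinite) path $p|t\to p_1|t_1\to\cdots$ (with $p_0=p$, $t_0=t$); it is successful if $t_n\xrightarrow{\omega}$ for some $n\ge0$. $p\ \mathbf{must\ satisfy}\ t$ if every computation of $p|t$ is successful. *)

theory Defs
  imports
    "HOL-Library.FSet"
    "HOL-Library.Countable_Set"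
    "HOL-Library.Extended_Nat"
begin

section \<open>Labelled transition systems\<close>

datatype 'a act = Tau | Ext 'a

definition act_tau :: "'a set \<Rightarrow> 'a act set" where
  "act_tau Act = insert Tau (Ext ` Act)"

type_synonym ('s, 'a) trans = "('s \<times> 'a act \<times> 's) set"

definition lts :: "'s set \<Rightarrow> 'a set \<Rightarrow> ('s, 'a) trans \<Rightarrow> bool" where
  "lts S Act T \<longleftrightarrow> countable S \<and> countable Act \<and> T \<subseteq> S \<times> act_tau Act \<times> S"

definition Succ :: "('s, 'a) trans \<Rightarrow> 's \<Rightarrow> 's set" where
  "Succ T s = {s'. \<exists>\<alpha>. (s, \<alpha>, s') \<in> T}"

definition finite_branching :: "'s set \<Rightarrow> ('s, 'a) trans \<Rightarrow> bool" where
  "finite_branching S T \<longleftrightarrow> (\<forall>s\<in>S. finite (Succ T s))"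

definition diverges :: "('s, 'a) trans \<Rightarrow> 's \<Rightarrow> bool" where
  "diverges T s \<longleftrightarrow> (\<exists>f :: nat \<Rightarrow> 's. f 0 = s \<and> (\<forall>n. (f n, Tau, f (Suc n)) \<in> T))"

abbreviation converges :: "('s, 'a) trans \<Rightarrow> 's \<Rightarrow> bool" where
  "converges T s \<equiv> \<not> diverges T s"

definition strong :: "('s, 'a) trans \<Rightarrow> 'a act \<Rightarrow> 's rel" where
  "strong T \<alpha> = {(s, s'). (s, \<alpha>, s') \<in> T}"

fun weak :: "('s, 'a) trans \<Rightarrow> 'a act \<Rightarrow> 's rel" where
  "weak T Tau = (strong T Tau)\<^sup>*"
| "weak T (Ext a) = (strong T Tau)\<^sup>* O strong T (Ext a) O (strong T Tau)\<^sup>*"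


section \<open>The language mustHML\<close>

text \<open>\<open>Box \<alpha> \<phi>\<close> is $[\alpha]\phi$ and \<open>Minfix X \<phi>\<close> is $\min(X,\phi)$.
  The generated set function \<open>fml_acts\<close> collects the external actions occurring in a formula.\<close>

datatype (fml_acts: 'a, 'v) fml =
    TT
  | FF
  | Acc "'a fset"
  | FVar 'v
  | Box "'a act" "('a, 'v) fml"
  | Conj "('a, 'v) fml" "('a, 'v) fml"
  | Minfix 'v "('a, 'v) fml"

primrec fml_fv :: "('a, 'v) fml \<Rightarrow> 'v set" where
  "fml_fv TT = {}"
| "fml_fv FF = {}"
| "fml_fv (Acc A) = {}"
| "fml_fv (FVar X) = {X}"
| "fml_fv (Box \<alpha> \<phi>) = fml_fv \<phi>"
| "fml_fv (Conj \<phi>1 \<phi>2) = fml_fv \<phi>1 \<union> fml_fv \<phi>2"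
| "fml_fv (Minfix X \<phi>) = fml_fv \<phi> - {X}"

definition mustHML :: "'a set \<Rightarrow> ('a, 'v) fml set" where
  "mustHML Act = {\<phi>. fml_acts \<phi> \<subseteq> Act \<and> fml_fv \<phi> = {}}"

primrec sem :: "'s set \<Rightarrow> ('s, 'a) trans \<Rightarrow> ('a, 'v) fml \<Rightarrow> ('v \<Rightarrow> 's set) \<Rightarrow> 's set" where
  "sem S T TT \<rho> = S"
| "sem S T FF \<rho> = {}"
| "sem S T (Acc A) \<rho> =
    {s \<in> S. converges T s \<and>
      (\<forall>s'. (s, s') \<in> weak T Tau \<longrightarrow> (\<exists>a. a |\<in>| A \<and> (\<exists>s''. (s', s'') \<in> weak T (Ext a))))}"
| "sem S T (FVar X) \<rho> = \<rho> X"
| "sem S T (Box \<alpha> \<phi>) \<rho> =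
    {s \<in> S. converges T s \<and> (\<forall>s'. (s, s') \<in> weak T \<alpha> \<longrightarrow> s' \<in> sem S T \<phi> \<rho>)}"
| "sem S T (Conj \<phi>1 \<phi>2) \<rho> = sem S T \<phi>1 \<rho> \<inter> sem S T \<phi>2 \<rho>"
| "sem S T (Minfix X \<phi>) \<rho> = \<Inter>{P. P \<subseteq> S \<and> sem S T \<phi> (\<rho>(X := P)) \<subseteq> P}"

lemma sem_cong:
  "(\<And>X. X \<in> fml_fv \<phi> \<Longrightarrow> \<rho> X = \<rho>' X) \<Longrightarrow> sem S T \<phi> \<rho> = sem S T \<phi> \<rho>'"
proof (induction \<phi> arbitrary: \<rho> \<rho>')
  case (Box \<alpha> \<phi>)
  have "sem S T \<phi> \<rho> = sem S T \<phi> \<rho>'"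
    by (rule Box.IH) (use Box.prems in auto)
  then show ?case by simp
next
  case (Conj \<phi>1 \<phi>2)
  have "sem S T \<phi>1 \<rho> = sem S T \<phi>1 \<rho>'"
    by (rule Conj.IH) (use Conj.prems in auto)
  moreover have "sem S T \<phi>2 \<rho> = sem S T \<phi>2 \<rho>'"
    by (rule Conj.IH) (use Conj.prems in auto)
  ultimately show ?case by simp
next
  case (Minfix X \<phi>)
  have "sem S T \<phi> (\<rho>(X := P)) = sem S T \<phi> (\<rho>'(X := P))" for P
    by (rule Minfix.IH) (use Minfix.prems in auto)
  then show ?case by simp
qed simp_all

text \<open>For a closed formula the environment is irrelevant, by \<open>sem_cong\<close>.\<close>

definition sem_closed :: "'s set \<Rightarrow> ('s, 'a) trans \<Rightarrow> ('a, 'v) fml \<Rightarrow> 's set" where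
  "sem_closed S T \<phi> = sem S T \<phi> (\<lambda>_. {})"


section \<open>Tests\<close>

text \<open>\<open>Done\<close> is the test $\omega.0$.\<close>

datatype (test_acts: 'a, 'v) test =
    TNil
  | Done
  | Pre "'a act" "('a, 'v) test"
  | TVar 'v
  | Plus "('a, 'v) test" "('a, 'v) test"
  | Mu 'v "('a, 'v) test"

datatype 'a test_label = Lab "'a act" | Omega

primrec test_fv :: "('a, 'v) test \<Rightarrow> 'v set" where
  "test_fv TNil = {}"
| "test_fv Done = {}"
| "test_fv (Pre \<alpha> t) = test_fv t"
| "test_fv (TVar X) = {X}"
| "test_fv (Plus t1 t2) = test_fv t1 \<union> test_fv t2"
| "test_fv (Mu X t) = test_fv t - {X}"

definition tests :: "'a set \<Rightarrow> ('a, 'v) test set" where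
  "tests Act = {t. test_acts t \<subseteq> Act \<and> test_fv t = {}}"

text \<open>\<open>subst t X u\<close> is $t\{u/X\}$. Bound variables are not renamed: on closed tests, the
  transition rules only substitute closed tests, so no variable can be captured.\<close>

primrec subst :: "('a, 'v) test \<Rightarrow> 'v \<Rightarrow> ('a, 'v) test \<Rightarrow> ('a, 'v) test" where
  "subst TNil X u = TNil"
| "subst Done X u = Done"
| "subst (Pre \<alpha> t) X u = Pre \<alpha> (subst t X u)"
| "subst (TVar Y) X u = (if Y = X then u else TVar Y)"
| "subst (Plus t1 t2) X u = Plus (subst t1 X u) (subst t2 X u)"
| "subst (Mu Y t) X u = (if Y = X then Mu Y t else Mu Y (subst t X u))"

inductive test_step :: "('a, 'v) test \<Rightarrow> 'a test_label \<Rightarrow> ('a, 'v) test \<Rightarrow> bool" where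
  pre: "test_step (Pre \<alpha> t) (Lab \<alpha>) t"
| omega: "test_step Done Omega TNil"
| plus1: "test_step t1 l t' \<Longrightarrow> test_step (Plus t1 t2) l t'"
| plus2: "test_step t2 l t' \<Longrightarrow> test_step (Plus t1 t2) l t'"
| unfold: "test_step (Mu X t) (Lab Tau) (subst t X (Mu X t))"


section \<open>Must testing\<close>

text \<open>The experiment $p \mid t$ is represented by the pair \<open>(p, t)\<close>.\<close>

inductive exp_step ::
    "('s, 'a) trans \<Rightarrow> 's \<times> ('a, 'v) test \<Rightarrow> 's \<times> ('a, 'v) test \<Rightarrow> bool" for T where
  proc: "(p, Tau, p') \<in> T \<Longrightarrow> exp_step T (p, t) (p', t)"
| test: "test_step t (Lab Tau) t' \<Longrightarrow> exp_step T (p, t) (p, t')"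
| sync: "(p, Ext a, p') \<in> T \<Longrightarrow> test_step t (Lab (Ext a)) t' \<Longrightarrow> exp_step T (p, t) (p', t')"

text \<open>A computation of length \<open>N\<close> visits \<open>f 0, f 1, \<dots>\<close> up to \<open>f N\<close> if \<open>N\<close> is finite, and all
  \<open>f n\<close> if \<open>N\<close> is infinite; values of \<open>f\<close> beyond a finite \<open>N\<close> are irrelevant.\<close>

definition computation ::
    "('s, 'a) trans \<Rightarrow> 's \<times> ('a, 'v) test \<Rightarrow> enat \<Rightarrow> (nat \<Rightarrow> 's \<times> ('a, 'v) test) \<Rightarrow> bool" where
  "computation T c N f \<longleftrightarrow>
    f 0 = c \<and>
    (\<forall>n. enat n < N \<longrightarrow> exp_step T (f n) (f (Suc n))) \<and>
    (\<forall>n. N = enat n \<longrightarrow> \<not> (\<exists>c'. exp_step T (f n) c'))"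

definition successful :: "enat \<Rightarrow> (nat \<Rightarrow> 's \<times> ('a, 'v) test) \<Rightarrow> bool" where
  "successful N f \<longleftrightarrow> (\<exists>n. enat n \<le> N \<and> (\<exists>t'. test_step (snd (f n)) Omega t'))"

definition must_satisfy :: "('s, 'a) trans \<Rightarrow> 's \<Rightarrow> ('a, 'v) test \<Rightarrow> bool" where
  "must_satisfy T p t \<longleftrightarrow> (\<forall>N f. computation T (p, t) N f \<longrightarrow> successful N f)"

definition must_represents ::
    "'s set \<Rightarrow> ('s, 'a) trans \<Rightarrow> ('a, 'v) fml \<Rightarrow> ('a, 'v) test \<Rightarrow> bool" where
  "must_represents S T \<phi> t \<longleftrightarrow> (\<forall>p\<in>S. must_satisfy T p t \<longleftrightarrow> p \<in> sem_closed S T \<phi>)"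

end

theory Submission imports Defs begin

text \<open>
  The translation sends \<open>[\<tau>]\<phi>\<close> to \<open>\<tau>.t\<close>, \<open>[a]\<phi>\<close> to \<open>a.t + \<tau>.\<omega>.0\<close>, a conjunction to
  \<open>\<tau>.t1 + \<tau>.t2\<close>, \<open>Acc A\<close> to the sum of the \<open>a.\<omega>.0\<close> and \<open>min(X, \<phi>)\<close> to \<open>\<mu>X.t\<close>. A test that is not
  immediately successful rejects all divergent processes, so formulas that are trivially true must
  be sent to \<open>\<omega>.0\<close> itself; every other formula holds of convergent processes only.

  Must satisfaction is the least predicate containing the immediately successful experiments and
  the experiments that can move and all of whose moves lead back into it. Hence the processes
  satisfying \<open>\<mu>X.t\<close> form a prefixed point of \<open>\<phi>\<close>, and well-founded induction along experiments
  shows that they lie in every prefixed point.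
\<close>

section \<open>Must satisfaction as a least fixed point\<close>

abbreviation succeeds :: "('a, 'v) test \<Rightarrow> bool" where
  "succeeds t \<equiv> \<exists>t'. test_step t Omega t'"

text \<open>The first premise of \<open>later\<close> excludes stuck experiments, which would
  otherwise satisfy the second one vacuously.\<close>

inductive will_succeed :: "('s, 'a) trans \<Rightarrow> 's \<times> ('a, 'v) test \<Rightarrow> bool" for T where
  now: "succeeds (snd c) \<Longrightarrow> will_succeed T c"
| later: "exp_step T c c' \<Longrightarrow> (\<And>d. exp_step T c d \<Longrightarrow> will_succeed T d) \<Longrightarrow> will_succeed T c"

lemma will_succeed_step:
  "will_succeed T c \<Longrightarrow> \<not> succeeds (snd c) \<Longrightarrow> exp_step T c d \<Longrightarrow> will_succeed T d"
  by (auto elim: will_succeed.cases)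

lemma will_succeed_computation:
  "will_succeed T c \<Longrightarrow> computation T c N f \<Longrightarrow> successful N f"
proof (induction arbitrary: N f rule: will_succeed.induct)
  case (now c)
  then have "enat 0 \<le> N \<and> succeeds (snd (f 0))"
    by (simp add: computation_def zero_enat_def[symmetric])
  then show ?case unfolding successful_def by blast
next
  case (later c c')
  then have f0: "f 0 = c" and st: "\<And>n. enat n < N \<Longrightarrow> exp_step T (f n) (f (Suc n))"
    and stuck: "\<And>n. N = enat n \<Longrightarrow> \<not> (\<exists>c'. exp_step T (f n) c')"
    by (auto simp: computation_def)
  \<comment> \<open>Since \<open>c\<close> can move, a computation from it has a first step; what
    follows is a computation of length \<open>M\<close> from a successor, to which the induction
    hypothesis applies.\<close>
  have "N \<noteq> enat 0" using stuck[of 0] f0 later.hyps(1) by metis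
  then obtain M where N: "N = eSuc M"
    by (metis enat.exhaust eSuc_enat eSuc_infinity old.nat.exhaust)
  have suc: "enat (Suc n) < N \<longleftrightarrow> enat n < M" "enat (Suc n) \<le> N \<longleftrightarrow> enat n \<le> M"
    "N = enat (Suc n) \<longleftrightarrow> M = enat n" for n
    using N by (auto simp: eSuc_enat[symmetric])
  have "exp_step T c (f 1)" using st[of 0] f0 N by (simp add: zero_enat_def[symmetric])
  moreover have "computation T (f 1) M (\<lambda>n. f (Suc n))"
    using st stuck suc by (simp add: computation_def)
  ultimately have "successful M (\<lambda>n. f (Suc n))" using later.IH by blast
  then show ?case unfolding successful_def using suc by blast
qed

text \<open>A failing experiment that can move has a failing successor. Choosing such successors
  until the experiment is stuck, or forever, gives an unsuccessful computation.\<close>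

lemma not_will_succeed_computation:
  fixes c :: "'s \<times> ('a, 'v) test"
  assumes "\<not> will_succeed T c"
  shows "\<exists>N f. computation T c N f \<and> \<not> successful N f"
proof -
  \<comment> \<open>At a stuck experiment the choice is arbitrary. This affects only values of
    \<open>f\<close> beyond the end of the computation.\<close>
  define next_of where "next_of d = (SOME e. exp_step T d e \<and> \<not> will_succeed T e)"
    for d :: "'s \<times> ('a, 'v) test"
  define f where "f n = (next_of ^^ n) c" for n
  have f0: "f 0 = c" and fS: "\<And>n. f (Suc n) = next_of (f n)" by (auto simp: f_def)
  let ?live = "\<lambda>d. \<exists>e. exp_step T d e"
  have nx: "exp_step T d (next_of d) \<and> \<not> will_succeed T (next_of d)"
    if "\<not> will_succeed T d" "?live d" for d
    unfolding next_of_def by (rule someI_ex) (use that in \<open>blast intro: will_succeed.later\<close>)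
  have bad: "\<not> will_succeed T (f n)" if "\<And>m. m < n \<Longrightarrow> ?live (f m)" for n
    using that by (induction n) (auto simp: f0 fS assms nx)
  have step: "exp_step T (f n) (f (Suc n))" if "\<And>m. m \<le> n \<Longrightarrow> ?live (f m)" for n
    using nx bad that by (auto simp: fS)
  show ?thesis
  proof (cases "\<forall>n. ?live (f n)")
    case True
    then have "computation T c \<infinity> f" using step f0 by (simp add: computation_def)
    moreover have "\<not> successful \<infinity> f"
      unfolding successful_def using bad True will_succeed.now by blast
    ultimately show ?thesis by blast
  next
    case False
    then obtain n where n: "\<not> ?live (f n)" and before: "\<And>m. m < n \<Longrightarrow> ?live (f m)"
      using exists_least_iff[of "\<lambda>n. \<not> ?live (f n)"] by metis
    have "computation T c (enat n) f" using step before n f0 by (auto simp: computation_def)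
    moreover have "\<not> succeeds (snd (f m))" if "m \<le> n" for m
      using bad[of m] before that will_succeed.now by fastforce
    then have "\<not> successful (enat n) f" unfolding successful_def by auto
    ultimately show ?thesis by blast
  qed
qed

lemma must_satisfy_iff_will_succeed: "must_satisfy T p t \<longleftrightarrow> will_succeed T (p, t)"
  unfolding must_satisfy_def
  using will_succeed_computation not_will_succeed_computation by blast

text \<open>An immediately successful experiment may move to a failing one, so
  \<open>will_succeed\<close> is preserved only by moves from the other experiments.\<close>

definition open_step ::
    "('s, 'a) trans \<Rightarrow> 's \<times> ('a, 'v) test \<Rightarrow> 's \<times> ('a, 'v) test \<Rightarrow> bool" where
  "open_step T c d \<longleftrightarrow> \<not> succeeds (snd c) \<and> exp_step T c d"

lemma will_succeed_open_step: "open_step T c d \<Longrightarrow> will_succeed T c \<Longrightarrow> will_succeed T d"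
  by (auto simp: open_step_def intro: will_succeed_step)

text \<open>The hypothesis covers all proper descendants because a \<mu>-test may come back to
  itself only several moves after its unfolding.\<close>

lemma will_succeed_tranclp_induct [consumes 1, case_names step]:
  fixes c :: "'s \<times> ('a, 'v) test"
  assumes "will_succeed T c"
    and step: "\<And>c. will_succeed T c \<Longrightarrow> (\<And>d. (open_step T)\<^sup>+\<^sup>+ c d \<Longrightarrow> Q d) \<Longrightarrow> Q c"
  shows "Q c"
proof -
  \<comment> \<open>Proving \<open>Q\<close> for all descendants at once supplies what
    \<open>step\<close> asks for.\<close>
  have "\<forall>d. (open_step T)\<^sup>*\<^sup>* c d \<longrightarrow> Q d"
    using assms(1)
  proof (induction rule: will_succeed.induct)
    case (now c)
    have no: "\<not> (open_step T)\<^sup>+\<^sup>+ c d" for d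
      using now by (auto simp: open_step_def dest: tranclpD)
    then have "Q c" using step[of c] will_succeed.now[OF now] by blast
    then show ?case using no by (metis rtranclpD)
  next
    case (later c c')
    have below: "Q d" if below: "(open_step T)\<^sup>+\<^sup>+ c d" for d
    proof -
      obtain e where "open_step T c e" "(open_step T)\<^sup>*\<^sup>* e d"
        using tranclpD[OF below] by blast
      then show ?thesis using later.IH[of e] unfolding open_step_def[of T c e] by blast
    qed
    moreover have "will_succeed T c" using later.hyps by (rule will_succeed.later)
    ultimately have "Q c" using step by blast
    then show ?case using below by (metis rtranclpD)
  qed
  then show ?thesis by blast
qed

section \<open>Convergent processes\<close>

text \<open>Convergence is well-foundedness of the \<tau>-moves below \<open>p\<close>: a
  counterexample would have a counterexample as \<tau>-successor, and dependent choice would yield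
  an infinite \<tau>-path.\<close>

lemma converges_induct [consumes 1, case_names step]:
  assumes "converges T p"
    and step: "\<And>p. (\<And>p'. (p, Tau, p') \<in> T \<Longrightarrow> Q p') \<Longrightarrow> Q p"
  shows "Q p"
proof (rule ccontr)
  assume p: "\<not> Q p"
  have "\<exists>f. f 0 = p \<and> (\<forall>n. \<not> Q (f n) \<and> (f n, Tau, f (Suc n)) \<in> T)"
  proof -
    have "\<exists>f. \<forall>n. (\<not> Q (f n) \<and> (n = 0 \<longrightarrow> f n = p)) \<and> (f n, Tau, f (Suc n)) \<in> T"
      by (rule dependent_nat_choice) (use p step in auto)
    then show ?thesis by blast
  qed
  then show False using assms(1) unfolding diverges_def by blast
qed

lemma diverges_step:
  assumes "diverges T p" shows "\<exists>p'. (p, Tau, p') \<in> T \<and> diverges T p'"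
proof -
  obtain f where f: "f 0 = p" "\<And>n. (f n, Tau, f (Suc n)) \<in> T"
    using assms by (auto simp: diverges_def)
  then have "diverges T (f 1)" unfolding diverges_def by (intro exI[of _ "\<lambda>n. f (Suc n)"]) simp
  then show ?thesis using f(1) f(2)[of 0] by auto
qed

text \<open>A divergent process can move forever while the test stays at \<open>u\<close>, where it
  has not succeeded.\<close>

lemma converges_if_will_succeed:
  "will_succeed T (p, u) \<Longrightarrow> \<not> succeeds u \<Longrightarrow> converges T p"
proof (induction "(p, u)" arbitrary: p rule: will_succeed.induct)
  case (later c')
  show ?case
  proof
    assume "diverges T p"
    from diverges_step[OF this] obtain p' where p': "(p, Tau, p') \<in> T" "diverges T p'"
      by (elim exE conjE)
    show False using later.hyps(3)[OF exp_step.proc[OF p'(1)] later.prems] p'(2) by (rule notE)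
  qed
next
  case now
  from now.prems now.hyps show ?case unfolding snd_conv by (rule notE)
qed

lemma subset_converges_if_will_succeed:
  "\<not> succeeds u \<Longrightarrow> P \<subseteq> {p \<in> S. will_succeed T (p, u)} \<Longrightarrow> P \<subseteq> {p \<in> S. converges T p}"
proof
  fix p assume "\<not> succeeds u" "P \<subseteq> {p \<in> S. will_succeed T (p, u)}" "p \<in> P"
  then show "p \<in> {p \<in> S. converges T p}" using converges_if_will_succeed[of T p u] by auto
qed

text \<open>Moves of the process alone leave \<open>u\<close> in place and, by convergence, come to
  an end. It remains to check, at every process reached by them, that the experiment is not stuck
  and that the moves involving the test are safe.\<close>

lemma will_succeedI:
  assumes "converges T p"
    and "\<And>q. (p, q) \<in> weak T Tau \<Longrightarrow> \<exists>d. exp_step T (q, u) d"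
    and "\<And>q u'. (p, q) \<in> weak T Tau \<Longrightarrow> test_step u (Lab Tau) u' \<Longrightarrow> will_succeed T (q, u')"
    and "\<And>q a q' u'. (p, q) \<in> weak T Tau \<Longrightarrow> (q, Ext a, q') \<in> T \<Longrightarrow>
      test_step u (Lab (Ext a)) u' \<Longrightarrow> will_succeed T (q', u')"
  shows "will_succeed T (p, u)"
  using assms
proof (induction p rule: converges_induct)
  case (step p)
  have tau: "(p, q) \<in> weak T Tau" if "(p, Tau, p') \<in> T" "(p', q) \<in> weak T Tau" for p' q
    using that by (auto simp: strong_def intro: converse_rtrancl_into_rtrancl)
  obtain d where d: "exp_step T (p, u) d" using step.prems(1)[of p] by (metis rtrancl.rtrancl_refl weak.simps(1))
  have "will_succeed T e" if "exp_step T (p, u) e" for e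
    using that
  proof cases
    case (proc p')
    show ?thesis unfolding proc(1)
      by (rule step.IH[OF proc(2)]) (use tau[OF proc(2)] step.prems(1-3) in blast)+
  next
    case (test u')
    then show ?thesis using step.prems(2)[of p u'] by simp
  next
    case (sync a p' u')
    then show ?thesis using step.prems(3)[of p a p' u'] by simp
  qed
  then show ?case by (rule will_succeed.later[OF d])
qed


section \<open>The translation\<close>

text \<open>Incomplete as a test for validity, but exact as a test for being satisfied by divergent
  processes.\<close>

primrec trivial :: "('a, 'v) fml \<Rightarrow> bool" where
  "trivial TT \<longleftrightarrow> True"
| "trivial FF \<longleftrightarrow> False"
| "trivial (Acc A) \<longleftrightarrow> False"
| "trivial (FVar X) \<longleftrightarrow> False"
| "trivial (Box \<alpha> \<phi>) \<longleftrightarrow> False"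
| "trivial (Conj \<phi> \<psi>) \<longleftrightarrow> trivial \<phi> \<and> trivial \<psi>"
| "trivial (Minfix X \<phi>) \<longleftrightarrow> trivial \<phi>"

lemma sem_trivial: "trivial \<phi> \<Longrightarrow> sem S T \<phi> \<rho> = S"
  by (induction \<phi> arbitrary: \<rho>) auto

text \<open>\<open>Acc\<close> and \<open>Box\<close> demand convergence outright, and a conjunction
  inherits it from a nontrivial conjunct. For \<open>Minfix\<close> the set of convergent states is
  itself a prefixed point.\<close>

lemma sem_nontrivial_converges:
  "\<not> trivial \<phi> \<Longrightarrow> (\<And>X. \<rho> X \<subseteq> {s \<in> S. converges T s}) \<Longrightarrow>
    sem S T \<phi> \<rho> \<subseteq> {s \<in> S. converges T s}"
proof (induction \<phi> arbitrary: \<rho>)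
  case (Conj \<phi> \<psi>)
  show ?case
  proof (cases "trivial \<phi>")
    case True
    then have "sem S T \<psi> \<rho> \<subseteq> {s \<in> S. converges T s}" using Conj by simp
    then show ?thesis by auto
  next
    case False
    then have "sem S T \<phi> \<rho> \<subseteq> {s \<in> S. converges T s}" using Conj by simp
    then show ?thesis by auto
  qed
next
  case (Minfix X \<phi>)
  let ?C = "{s \<in> S. converges T s}"
  have "sem S T \<phi> (\<rho>(X := ?C)) \<subseteq> ?C" by (rule Minfix.IH) (use Minfix.prems in auto)
  then have "?C \<in> {P. P \<subseteq> S \<and> sem S T \<phi> (\<rho>(X := P)) \<subseteq> P}" by auto
  then show ?case unfolding sem.simps by (rule Inter_lower)
qed auto

definition list_of_fset :: "'a fset \<Rightarrow> 'a list" where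
  "list_of_fset A = (SOME xs. set xs = fset A)"

lemma set_list_of_fset [simp]: "set (list_of_fset A) = fset A"
  unfolding list_of_fset_def by (rule someI_ex) (simp add: finite_list)

primrec accept :: "'a list \<Rightarrow> ('a, 'v) test" where
  "accept [] = TNil"
| "accept (a # as) = Plus (Pre (Ext a) Done) (accept as)"

text \<open>Carrying the tests substituted for the free variables along in \<open>\<sigma>\<close> makes unfolding a \<open>\<mu>\<close>
  an update of \<open>\<sigma>\<close>; see \<open>to_test_unfold\<close>.\<close>

fun to_test :: "('a, 'v) fml \<Rightarrow> ('v \<Rightarrow> ('a, 'v) test) \<Rightarrow> ('a, 'v) test" where
  "to_test TT \<sigma> = Done"
| "to_test FF \<sigma> = TNil"
| "to_test (Acc A) \<sigma> = accept (list_of_fset A)"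
| "to_test (FVar X) \<sigma> = \<sigma> X"
| "to_test (Box \<alpha> \<phi>) \<sigma> =
    (case \<alpha> of
      Tau \<Rightarrow> Pre Tau (to_test \<phi> \<sigma>)
    | Ext a \<Rightarrow> Plus (Pre (Ext a) (to_test \<phi> \<sigma>)) (Pre Tau Done))"
| "to_test (Conj \<phi> \<psi>) \<sigma> =
    (if trivial \<phi> \<and> trivial \<psi> then Done
     else Plus (Pre Tau (to_test \<phi> \<sigma>)) (Pre Tau (to_test \<psi> \<sigma>)))"
| "to_test (Minfix X \<phi>) \<sigma> =
    (if trivial \<phi> then Done else Mu X (to_test \<phi> (\<sigma>(X := TVar X))))"

section \<open>Substitution, free variables and moves of translated tests\<close>

lemma subst_notin_fv: "X \<notin> test_fv t \<Longrightarrow> subst t X u = t"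
  by (induction t) auto

lemma accept_fv [simp]: "test_fv (accept as) = {}"
  by (induction as) auto

lemma accept_acts [simp]: "test_acts (accept as) = set as"
  by (induction as) auto

text \<open>The hypothesis leaves the placeholder \<open>TVar X\<close> as the only source of free
  occurrences of \<open>X\<close>. Neither side renames bound variables, so the two agree
  syntactically, even for open \<open>u\<close>.\<close>

lemma subst_to_test:
  "(\<And>Y. Y \<noteq> X \<Longrightarrow> X \<notin> test_fv (\<sigma> Y)) \<Longrightarrow>
    subst (to_test \<phi> (\<sigma>(X := TVar X))) X u = to_test \<phi> (\<sigma>(X := u))"
proof (induction \<phi> arbitrary: \<sigma>)
  case (Minfix Y \<phi>)
  show ?case
  proof (cases "Y = X")
    case False
    have "subst (to_test \<phi> ((\<sigma>(Y := TVar Y))(X := TVar X))) X u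
        = to_test \<phi> ((\<sigma>(Y := TVar Y))(X := u))"
      by (rule Minfix.IH) (use Minfix.prems False in auto)
    then show ?thesis using False by (simp add: fun_upd_twist[OF False] del: fun_upd_apply)
  qed (simp del: fun_upd_apply)
qed (auto simp: subst_notin_fv split: act.split)

lemma to_test_fv: "test_fv (to_test \<phi> \<sigma>) \<subseteq> (\<Union>Y\<in>fml_fv \<phi>. test_fv (\<sigma> Y))"
proof (induction \<phi> arbitrary: \<sigma>)
  case (Minfix X \<phi>)
  then have "test_fv (to_test \<phi> (\<sigma>(X := TVar X)))
      \<subseteq> (\<Union>Y\<in>fml_fv \<phi>. test_fv ((\<sigma>(X := TVar X)) Y))" .
  also have "\<dots> \<subseteq> insert X (\<Union>Y\<in>fml_fv \<phi> - {X}. test_fv (\<sigma> Y))"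
    by (auto split: if_splits)
  finally show ?case by auto
next
  case (Box \<alpha> \<phi>)
  then show ?case using Box[of \<sigma>] by (auto split: act.split)
next
  case (Conj \<phi> \<psi>)
  show ?case using Conj.IH(1)[of \<sigma>] Conj.IH(2)[of \<sigma>] by auto
qed auto

lemma to_test_acts:
  "(\<And>X. test_acts (\<sigma> X) = {}) \<Longrightarrow> test_acts (to_test \<phi> \<sigma>) \<subseteq> fml_acts \<phi>"
proof (induction \<phi> arbitrary: \<sigma>)
  case (Minfix X \<phi>)
  have "test_acts (to_test \<phi> (\<sigma>(X := TVar X))) \<subseteq> fml_acts \<phi>"
    by (rule Minfix.IH) (use Minfix.prems in auto)
  then show ?case by simp
next
  case (Box \<alpha> \<phi>)
  then show ?case using Box.IH[of \<sigma>] by (auto split: act.split)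
next
  case (Conj \<phi> \<psi>)
  then show ?case using Conj.IH(1)[of \<sigma>] Conj.IH(2)[of \<sigma>] by auto
qed auto

inductive_cases test_stepE:
  "test_step TNil l u" "test_step Done l u" "test_step (Pre \<alpha> t) l u"
  "test_step (Plus t1 t2) l u" "test_step (Mu X t) l u"

lemma accept_step:
  "test_step (accept as) l u \<longleftrightarrow> (\<exists>a\<in>set as. l = Lab (Ext a)) \<and> u = Done"
proof (induction as)
  case (Cons b as)
  then show ?case by (auto elim!: test_stepE intro: test_step.intros)
qed (auto elim: test_stepE)

lemma succeeds_Done [simp]: "succeeds Done"
  by (auto intro: test_step.omega)

lemma will_succeed_Done [simp]: "will_succeed T (p, Done)"
  by (simp add: will_succeed.now)

lemma to_test_trivial: "trivial \<phi> \<Longrightarrow> to_test \<phi> \<sigma> = Done"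
  by (cases \<phi>) auto

text \<open>Tests of nontrivial formulas are \<open>TNil\<close>, prefixes, sums without the summand
  \<open>Done\<close>, a \<open>Mu\<close>, or some \<open>\<sigma> X\<close>; none of these
  succeeds at once.\<close>

lemma to_test_succeeds_iff:
  assumes "\<And>X. \<not> succeeds (\<sigma> X)"
  shows "succeeds (to_test \<phi> \<sigma>) \<longleftrightarrow> trivial \<phi>"
  using assms
  by (cases \<phi>) (auto simp: accept_step intro: test_step.omega elim!: test_stepE split: act.splits)

text \<open>The unfolded test is again a translation, namely of the body, so the inductions on
  formulas below never have to handle substitution.\<close>

lemma to_test_unfold:
  assumes "\<And>X. test_fv (\<sigma> X) = {}" "\<not> trivial \<phi>"
  shows "test_step (to_test (Minfix X \<phi>) \<sigma>) l u \<longleftrightarrow>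
    l = Lab Tau \<and> u = to_test \<phi> (\<sigma>(X := to_test (Minfix X \<phi>) \<sigma>))"
proof -
  have "test_step (Mu X t) l u \<longleftrightarrow> l = Lab Tau \<and> u = subst t X (Mu X t)" for t
    by (auto elim: test_stepE intro: test_step.unfold)
  then show ?thesis using assms subst_to_test[of X \<sigma> \<phi>] by simp
qed

lemma to_test_closed:
  "(\<And>X. test_fv (\<sigma> X) = {}) \<Longrightarrow> test_fv (to_test \<phi> \<sigma>) = {}"
  using to_test_fv[of \<phi> \<sigma>] by auto

lemma weak_in_states:
  assumes "T \<subseteq> S \<times> UNIV \<times> S" "(p, q) \<in> weak T \<alpha>" "p \<in> S"
  shows "q \<in> S"
proof -
  have tau: "y \<in> S" if "(x, y) \<in> (strong T Tau)\<^sup>*" "x \<in> S" for x y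
    using that by (induction rule: rtrancl_induct) (use assms(1) in \<open>auto simp: strong_def\<close>)
  show ?thesis
  proof (cases \<alpha>)
    case Tau
    then show ?thesis using assms tau by simp
  next
    case (Ext a)
    then obtain q1 q2 where "(q1, Ext a, q2) \<in> T" "(q2, q) \<in> (strong T Tau)\<^sup>*"
      using assms(2) by (auto simp: strong_def)
    then show ?thesis using assms(1) tau by blast
  qed
qed


section \<open>Every process satisfying the formula satisfies the test\<close>

lemma will_succeed_weak:
  assumes "(p, q) \<in> weak T Tau" "will_succeed T (p, u)"
  shows "will_succeed T (q, u)"
proof (cases "succeeds u")
  case False
  show ?thesis
    using assms unfolding weak.simps
    by (induction rule: rtrancl_induct)
      (use False in \<open>auto simp: strong_def intro: will_succeed_step exp_step.proc\<close>)
qed (simp add: will_succeed.now)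

text \<open>With \<open>\<sigma>\<close> and \<open>\<rho>\<close> general, a variable bound by
  \<open>Minfix\<close> can be assigned the \<mu>-test and the set of processes satisfying it. As no
  \<open>\<sigma> X\<close> succeeds at once, the sets in \<open>\<rho>\<close> contain convergent
  processes only.\<close>

lemma sem_subset_will_succeed:
  "(\<And>X. test_fv (\<sigma> X) = {}) \<Longrightarrow> (\<And>X. \<not> succeeds (\<sigma> X)) \<Longrightarrow>
    (\<And>X. \<rho> X \<subseteq> {p \<in> S. will_succeed T (p, \<sigma> X)}) \<Longrightarrow>
    sem S T \<phi> \<rho> \<subseteq> {p \<in> S. will_succeed T (p, to_test \<phi> \<sigma>)}"
proof (induction \<phi> arbitrary: \<sigma> \<rho>)
  case (Acc A)
  have "will_succeed T (p, accept (list_of_fset A))" if p: "p \<in> sem S T (Acc A) \<rho>" for p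
  proof (rule will_succeedI)
    show "converges T p" using p by simp
  next
    fix q assume q: "(p, q) \<in> weak T Tau"
    with p obtain a r where a: "a |\<in>| A" and "(q, r) \<in> weak T (Ext a)"
      unfolding sem.simps by blast
    then obtain q1 q2 where q1: "(q, q1) \<in> (strong T Tau)\<^sup>*" and q2: "(q1, Ext a, q2) \<in> T"
      by (auto simp: strong_def)
    \<comment> \<open>Either \<open>q\<close> itself offers \<open>a\<close>, or it has a
      \<tau>-move; both keep the experiment from being stuck.\<close>
    from q1 show "\<exists>d. exp_step T (q, accept (list_of_fset A)) d"
    proof (cases rule: converse_rtranclE)
      case base
      have "test_step (accept (list_of_fset A)) (Lab (Ext a)) Done"
        using a by (simp add: accept_step)
      then show ?thesis using q2 base by (blast intro: exp_step.sync)
    next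
      case (step y)
      then show ?thesis by (auto simp: strong_def intro: exp_step.proc)
    qed
  qed (auto simp: accept_step)
  then show ?case by auto
next
  case (Box \<alpha> \<phi>)
  have IH: "sem S T \<phi> \<rho> \<subseteq> {p \<in> S. will_succeed T (p, to_test \<phi> \<sigma>)}"
    by (rule Box.IH) (use Box.prems in auto)
  have "will_succeed T (p, to_test (Box \<alpha> \<phi>) \<sigma>)" if p: "p \<in> sem S T (Box \<alpha> \<phi>) \<rho>" for p
  proof (rule will_succeedI)
    show "converges T p" using p by simp
  next
    fix q
    \<comment> \<open>For \<open>Ext a\<close> the summand \<open>Pre Tau Done\<close> provides this
      move, also where \<open>q\<close> cannot do \<open>a\<close>.\<close>
    have "\<exists>v. test_step (to_test (Box \<alpha> \<phi>) \<sigma>) (Lab Tau) v"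
      by (cases \<alpha>) (auto intro: test_step.intros)
    then show "\<exists>d. exp_step T (q, to_test (Box \<alpha> \<phi>) \<sigma>) d"
      by (blast intro: exp_step.test)
  next
    fix q u assume q: "(p, q) \<in> weak T Tau" "test_step (to_test (Box \<alpha> \<phi>) \<sigma>) (Lab Tau) u"
    then show "will_succeed T (q, u)"
      using p IH by (cases \<alpha>) (auto elim!: test_stepE)
  next
    fix q a q' u assume q: "(p, q) \<in> weak T Tau" "(q, Ext a, q') \<in> T"
      "test_step (to_test (Box \<alpha> \<phi>) \<sigma>) (Lab (Ext a)) u"
    then have \<alpha>: "\<alpha> = Ext a" "u = to_test \<phi> \<sigma>"
      by (cases \<alpha>; auto elim!: test_stepE)+
    moreover have "(p, q') \<in> weak T (Ext a)" using q by (auto simp: strong_def)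
    ultimately show "will_succeed T (q', u)" using p IH by auto
  qed
  then show ?case by auto
next
  case (Conj \<phi> \<psi>)
  show ?case
  proof (cases "trivial (Conj \<phi> \<psi>)")
    case True
    then show ?thesis using sem_trivial[OF True, of S T \<rho>] by (simp add: to_test_trivial)
  next
    case False
    have IH: "sem S T \<phi> \<rho> \<subseteq> {p \<in> S. will_succeed T (p, to_test \<phi> \<sigma>)}"
      "sem S T \<psi> \<rho> \<subseteq> {p \<in> S. will_succeed T (p, to_test \<psi> \<sigma>)}"
      using Conj by auto
    have \<rho>: "\<rho> X \<subseteq> {s \<in> S. converges T s}" for X
      by (rule subset_converges_if_will_succeed[OF Conj.prems(2,3)])
    have "will_succeed T (p, to_test (Conj \<phi> \<psi>) \<sigma>)" if p: "p \<in> sem S T (Conj \<phi> \<psi>) \<rho>" for p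
    proof (rule will_succeedI)
      show "converges T p" using sem_nontrivial_converges[of "Conj \<phi> \<psi>" \<rho> S T, OF False \<rho>] p by blast
    next
      fix q u assume "(p, q) \<in> weak T Tau" "test_step (to_test (Conj \<phi> \<psi>) \<sigma>) (Lab Tau) u"
      \<comment> \<open>The formula speaks of \<open>p\<close>, but the test may choose its branch
        only after \<open>p\<close> has become \<open>q\<close>; \<open>will_succeed_weak\<close>
        bridges the gap.\<close>
      moreover have "will_succeed T (p, to_test \<phi> \<sigma>)" "will_succeed T (p, to_test \<psi> \<sigma>)"
        using p IH by auto
      ultimately show "will_succeed T (q, u)"
        using False by (auto elim!: test_stepE intro: will_succeed_weak)
    next
      fix q
      have "test_step (to_test (Conj \<phi> \<psi>) \<sigma>) (Lab Tau) (to_test \<phi> \<sigma>)"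
        using False by (auto intro: test_step.intros)
      then show "\<exists>d. exp_step T (q, to_test (Conj \<phi> \<psi>) \<sigma>) d" by (blast intro: exp_step.test)
    qed (use False in \<open>auto elim!: test_stepE\<close>)
    moreover have "sem S T (Conj \<phi> \<psi>) \<rho> \<subseteq> S" using IH by auto
    ultimately show ?thesis by blast
  qed
next
  case (Minfix X \<phi>)
  show ?case
  proof (cases "trivial (Minfix X \<phi>)")
    case True
    then show ?thesis using sem_trivial[OF True, of S T \<rho>] by (simp add: to_test_trivial)
  next
    case False
    define u where "u = to_test (Minfix X \<phi>) \<sigma>"
    \<comment> \<open>The candidate for a prefixed point of the body.\<close>
    define P where "P = {p \<in> S. will_succeed T (p, u)}"
    have u: "\<not> succeeds u" "test_fv u = {}"
      unfolding u_def
      using to_test_succeeds_iff[of \<sigma> "Minfix X \<phi>"] to_test_closed[of \<sigma>] False Minfix.prems(1,2)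
      by blast+
    have u_step: "test_step u l v \<longleftrightarrow> l = Lab Tau \<and> v = to_test \<phi> (\<sigma>(X := u))" for l v
      unfolding u_def by (rule to_test_unfold) (use Minfix.prems False in auto)
    have IH: "sem S T \<phi> (\<rho>(X := P)) \<subseteq> {p \<in> S. will_succeed T (p, to_test \<phi> (\<sigma>(X := u)))}"
      by (rule Minfix.IH) (use Minfix.prems u in \<open>auto simp: P_def\<close>)
    have \<rho>: "(\<rho>(X := P)) Y \<subseteq> {s \<in> S. converges T s}" for Y
      by (rule subset_converges_if_will_succeed[of "(\<sigma>(X := u)) Y"])
        (use Minfix.prems(2,3) u(1) in \<open>auto simp: P_def\<close>)
    have "sem S T \<phi> (\<rho>(X := P)) \<subseteq> P"
    proof
      fix p assume p: "p \<in> sem S T \<phi> (\<rho>(X := P))"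
      have "will_succeed T (p, u)"
      proof (rule will_succeedI)
        show "converges T p" using sem_nontrivial_converges[of \<phi> "\<rho>(X := P)" S T, OF _ \<rho>] False p by auto
      next
        fix q
        have "test_step u (Lab Tau) (to_test \<phi> (\<sigma>(X := u)))" by (simp only: u_step simp_thms)
        then show "\<exists>d. exp_step T (q, u) d" by (blast intro: exp_step.test)
      next
        fix q v assume q: "(p, q) \<in> weak T Tau" and "test_step u (Lab Tau) v"
        then have v: "v = to_test \<phi> (\<sigma>(X := u))" by (simp only: u_step)
        have "will_succeed T (p, v)" using p IH unfolding v by blast
        then show "will_succeed T (q, v)" by (rule will_succeed_weak[OF q])
      qed (simp add: u_step)
      then show "p \<in> P" using p IH by (auto simp: P_def)
    qed
    then have "P \<in> {P. P \<subseteq> S \<and> sem S T \<phi> (\<rho>(X := P)) \<subseteq> P}" by (auto simp: P_def)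
    then have "sem S T (Minfix X \<phi>) \<rho> \<subseteq> P" unfolding sem.simps by (rule Inter_lower)
    then show ?thesis unfolding P_def u_def .
  qed
qed (auto)


section \<open>Every process satisfying the test satisfies the formula\<close>

text \<open>The largest such set, all of \<open>will_succeed\<close>, gives the theorem; smaller
  ones serve the induction at \<open>Minfix\<close>.\<close>

definition winning :: "('s, 'a) trans \<Rightarrow> ('s \<times> ('a, 'v) test) set \<Rightarrow> bool" where
  "winning T D \<longleftrightarrow> (\<forall>c\<in>D. will_succeed T c \<and> (\<forall>d. open_step T c d \<longrightarrow> d \<in> D))"

lemma winning_will_succeed: "winning T D \<Longrightarrow> c \<in> D \<Longrightarrow> will_succeed T c"
  and winning_step: "winning T D \<Longrightarrow> c \<in> D \<Longrightarrow> open_step T c d \<Longrightarrow> d \<in> D"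
  by (auto simp only: winning_def)

lemma winning_weak:
  assumes "winning T D" "\<not> succeeds u" "(p, q) \<in> weak T Tau" "(p, u) \<in> D"
  shows "(q, u) \<in> D"
  using assms(3) unfolding weak.simps
proof (induction rule: rtrancl_induct)
  case (step y z)
  then have "open_step T (y, u) (z, u)"
    using assms(2) by (auto simp: open_step_def strong_def intro: exp_step.proc)
  then show ?case by (rule winning_step[OF assms(1) step.IH])
qed (rule assms)

lemma winning_tau:
  assumes "winning T D" "\<not> succeeds u" "(p, u) \<in> D" "test_step u (Lab Tau) v"
  shows "(p, v) \<in> D"
  by (rule winning_step[OF assms(1,3)])
    (simp only: open_step_def snd_conv assms(2) exp_step.test[OF assms(4)] not_False_eq_True simp_thms)

lemma winning_converges:
  "winning T D \<Longrightarrow> \<not> succeeds u \<Longrightarrow> (p, u) \<in> D \<Longrightarrow> converges T p"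
  by (rule converges_if_will_succeed[OF winning_will_succeed])

text \<open>\<open>accept as\<close> neither succeeds at once nor has \<tau>-moves, so the process
  has to run alone until it synchronises on some \<open>a\<close>. Its \<tau>-moves and that
  \<open>a\<close> form the weak transition.\<close>

lemma will_succeed_accept:
  fixes T :: "('s, 'a) trans"
  assumes "will_succeed T (p, accept as :: ('a, 'v) test)"
  shows "\<exists>a\<in>set as. \<exists>q. (p, q) \<in> weak T (Ext a)"
  using assms
proof (induction "(p, accept as :: ('a, 'v) test)" arbitrary: p rule: will_succeed.induct)
  case (later c)
  from later.hyps(1) show ?case
  proof cases
    case (proc p')
    then obtain a q where "a \<in> set as" "(p', q) \<in> weak T (Ext a)"
      using later.hyps by (metis exp_step.proc)
    moreover have "(p, p') \<in> strong T Tau" using proc by (simp add: strong_def)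
    ultimately show ?thesis by (auto intro: converse_rtrancl_into_rtrancl)
  next
    case (sync a p' t')
    then have "a \<in> set as" "(p, p') \<in> strong T (Ext a)" by (auto simp: accept_step strong_def)
    then show ?thesis by auto
  qed (simp add: accept_step)
next
  case now
  then show ?case by (auto simp: accept_step)
qed

lemma not_will_succeed_TNil: "\<not> will_succeed T (p, TNil)"
  using will_succeed_accept[of T p "[]"] by auto

text \<open>In the case of \<open>Minfix\<close> the environment is only known to be large enough on experiments
  reachable from the current one, so the induction runs relative to a set \<open>D\<close> of experiments.\<close>

lemma winning_subset_sem:
  fixes T :: "('s, 'a) trans" and \<phi> :: "('a, 'v) fml"
  assumes T: "T \<subseteq> S \<times> UNIV \<times> S"
  shows "(\<And>X. test_fv (\<sigma> X) = {}) \<Longrightarrow> (\<And>X. \<not> succeeds (\<sigma> X)) \<Longrightarrow> winning T D \<Longrightarrow>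
    (\<And>X. {p \<in> S. (p, \<sigma> X) \<in> D} \<subseteq> \<rho> X) \<Longrightarrow>
    {p \<in> S. (p, to_test \<phi> \<sigma>) \<in> D} \<subseteq> sem S T \<phi> \<rho>"
proof (induction \<phi> arbitrary: \<sigma> \<rho> D)
  case FF
  then show ?case by (auto simp: winning_def not_will_succeed_TNil)
next
  case (Acc A)
  let ?u = "accept (list_of_fset A) :: ('a, 'v) test"
  have u: "\<not> succeeds ?u" by (simp add: accept_step)
  have "p \<in> sem S T (Acc A) \<rho>" if "p \<in> S" "(p, ?u) \<in> D" for p
  proof -
    have "\<exists>a. a |\<in>| A \<and> (\<exists>s. (q, s) \<in> weak T (Ext a))" if "(p, q) \<in> weak T Tau" for q
    proof -
      have "will_succeed T (q, ?u)"
        using winning_weak[OF Acc.prems(3) u that] \<open>(p, ?u) \<in> D\<close> Acc.prems(3)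
        by (auto simp: winning_def)
      then show ?thesis using will_succeed_accept by fastforce
    qed
    then show ?thesis using that winning_converges[OF Acc.prems(3) u] by simp
  qed
  then show ?case by auto
next
  case (Box \<alpha> \<phi>)
  let ?u = "to_test (Box \<alpha> \<phi>) \<sigma>" and ?t = "to_test \<phi> \<sigma>"
  have u: "\<not> succeeds ?u" using to_test_succeeds_iff[of \<sigma> "Box \<alpha> \<phi>"] Box.prems(2) by simp
  have IH: "{p \<in> S. (p, ?t) \<in> D} \<subseteq> sem S T \<phi> \<rho>"
    by (rule Box.IH) (use Box.prems in auto)
  have "q \<in> sem S T \<phi> \<rho>" if p: "p \<in> S" "(p, ?u) \<in> D" "(p, q) \<in> weak T \<alpha>" for p q
  \<comment> \<open>If \<open>?t\<close> succeeds at once, \<open>D\<close> need not be closed under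
    further moves of the process, but then \<phi> holds in every state.\<close>
  proof (cases "trivial \<phi>")
    case True
    then show ?thesis using weak_in_states[OF T p(3,1)] by (simp add: sem_trivial)
  next
    case False
    then have t: "\<not> succeeds ?t" using to_test_succeeds_iff[of \<sigma> \<phi>] Box.prems(2) by simp
    have "(q, ?t) \<in> D"
    proof (cases \<alpha>)
      case Tau
      then have "(q, ?u) \<in> D" using winning_weak[OF Box.prems(3) u] p by blast
      then show ?thesis
        by (rule winning_tau[OF Box.prems(3) u]) (simp add: Tau test_step.pre)
    next
      case (Ext a)
      obtain q1 q2 where q: "(p, q1) \<in> weak T Tau" "(q1, Ext a, q2) \<in> T" "(q2, q) \<in> weak T Tau"
        using p(3) Ext by (auto simp: strong_def)
      have "(q1, ?u) \<in> D" using winning_weak[OF Box.prems(3) u q(1) p(2)] .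
      moreover have "test_step ?u (Lab (Ext a)) ?t"
        using Ext by (auto intro: test_step.intros)
      then have "open_step T (q1, ?u) (q2, ?t)"
        using u q(2) by (auto simp: open_step_def intro: exp_step.sync)
      ultimately have "(q2, ?t) \<in> D" using Box.prems(3) by (auto simp: winning_def)
      then show ?thesis using winning_weak[OF Box.prems(3) t q(3)] by blast
    qed
    then show ?thesis using IH weak_in_states[OF T p(3,1)] by blast
  qed
  then show ?case using winning_converges[OF Box.prems(3) u] by auto
next
  case (Conj \<phi> \<psi>)
  show ?case
  proof (cases "trivial (Conj \<phi> \<psi>)")
    case True
    then show ?thesis using sem_trivial[OF True, of S T \<rho>] by auto
  next
    case False
    let ?u = "to_test (Conj \<phi> \<psi>) \<sigma>"
    have u: "\<not> succeeds ?u" using to_test_succeeds_iff[of \<sigma> "Conj \<phi> \<psi>"] Conj.prems(2) False by blast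
    have steps: "test_step ?u (Lab Tau) (to_test \<phi> \<sigma>)" "test_step ?u (Lab Tau) (to_test \<psi> \<sigma>)"
      using False by (auto intro: test_step.intros)
    have "{p \<in> S. (p, to_test \<phi> \<sigma>) \<in> D} \<subseteq> sem S T \<phi> \<rho>"
      "{p \<in> S. (p, to_test \<psi> \<sigma>) \<in> D} \<subseteq> sem S T \<psi> \<rho>"
      using Conj by auto
    then show ?thesis
      using winning_tau[OF Conj.prems(3) u _ steps(1)] winning_tau[OF Conj.prems(3) u _ steps(2)]
      unfolding sem.simps by blast
  qed
next
  case (Minfix X \<phi>)
  show ?case
  proof (cases "trivial (Minfix X \<phi>)")
    case True
    then show ?thesis using sem_trivial[OF True, of S T \<rho>] by auto
  next
    case False
    define u where "u = to_test (Minfix X \<phi>) \<sigma>"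
    have u: "\<not> succeeds u" "test_fv u = {}"
      unfolding u_def
      using to_test_succeeds_iff[of \<sigma> "Minfix X \<phi>"] to_test_closed[of \<sigma>] False Minfix.prems(1,2)
      by blast+
    have u_step: "test_step u l v \<longleftrightarrow> l = Lab Tau \<and> v = to_test \<phi> (\<sigma>(X := u))" for l v
      unfolding u_def by (rule to_test_unfold) (use Minfix.prems False in auto)
    have "p \<in> P" if P: "P \<subseteq> S" "sem S T \<phi> (\<rho>(X := P)) \<subseteq> P" and p: "p \<in> S" "(p, u) \<in> D" for P p
    proof -
      \<comment> \<open>Well-founded induction along experiments, of which only those with test
        \<open>u\<close> matter.\<close>
      have "\<forall>p. c = (p, u) \<longrightarrow> p \<in> S \<longrightarrow> c \<in> D \<longrightarrow> p \<in> P" if "will_succeed T c" for c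
        using that
      proof (induction rule: will_succeed_tranclp_induct)
        case (step c)
        show ?case
        proof (intro allI impI)
          fix p assume c: "c = (p, u)" and p: "p \<in> S" and cD: "c \<in> D"
          \<comment> \<open>The experiments strictly below \<open>c\<close>. By the induction
            hypothesis every process of \<open>S\<close> paired with \<open>u\<close> in
            \<open>E\<close> lies in \<open>P\<close>, so \<open>\<rho>(X := P)\<close> is large
            enough relative to \<open>E\<close>, as it need not be relative to
            \<open>D\<close>.\<close>
          define E where "E = {d. (open_step T)\<^sup>+\<^sup>+ c d}"
          have "d \<in> D" if "(open_step T)\<^sup>+\<^sup>+ c d" for d
            using that cD Minfix.prems(3)
            by (induction rule: tranclp_induct) (auto simp: winning_def)
          then have ED: "E \<subseteq> D" by (auto simp: E_def)
          have "{p \<in> S. (p, to_test \<phi> (\<sigma>(X := u))) \<in> E} \<subseteq> sem S T \<phi> (\<rho>(X := P))"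
          proof (rule Minfix.IH)
            show "winning T E"
              using ED Minfix.prems(3) unfolding winning_def E_def
              by (blast intro: tranclp.trancl_into_trancl)
            show "{p \<in> S. (p, (\<sigma>(X := u)) Y) \<in> E} \<subseteq> (\<rho>(X := P)) Y" for Y
            proof (cases "Y = X")
              case True
              then show ?thesis using step.IH ED by (auto simp: E_def)
            next
              case False
              then show ?thesis using Minfix.prems(4)[of Y] ED by auto
            qed
          qed (use Minfix.prems u in auto)
          moreover have "exp_step T c (p, to_test \<phi> (\<sigma>(X := u)))"
            unfolding c by (rule exp_step.test) (simp only: u_step simp_thms)
          then have "open_step T c (p, to_test \<phi> (\<sigma>(X := u)))"
            using c u(1) by (simp add: open_step_def)
          \<comment> \<open>Unfolding costs one move, which places the unfolded experiment strictly
            below \<open>c\<close>. Hence \<open>p\<close> satisfies the body under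
            \<open>\<rho>(X := P)\<close>, and \<open>P\<close> is a prefixed point.\<close>
          then have "(p, to_test \<phi> (\<sigma>(X := u))) \<in> E" by (auto simp: E_def)
          ultimately show "p \<in> P" using p P(2) by blast
        qed
      qed
      then show ?thesis using p Minfix.prems(3) by (auto simp: winning_def)
    qed
    then show ?thesis unfolding sem.simps u_def by blast
  qed
qed auto


theorem theorem4p14:
  fixes S :: "'s set" and Act :: "'a set" and T :: "('s, 'a) trans"
  assumes "lts S Act T"
    and "finite_branching S T"
  shows "\<forall>\<phi> :: ('a, 'v::countable) fml. \<phi> \<in> mustHML Act \<longrightarrow>
    (\<exists>t :: ('a, 'v) test. t \<in> tests Act \<and> must_represents S T \<phi> t)"
proof (intro allI impI)
  fix \<phi> :: "('a, 'v) fml" assume \<phi>: "\<phi> \<in> mustHML Act"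
  \<comment> \<open>No process satisfies \<open>TNil\<close>, which matches the empty environment of
    \<open>sem_closed\<close> in both inclusions.\<close>
  define \<sigma> :: "'v \<Rightarrow> ('a, 'v) test" where "\<sigma> = (\<lambda>_. TNil)"
  let ?t = "to_test \<phi> \<sigma>" and ?W = "{c. will_succeed T c} :: ('s \<times> ('a, 'v) test) set"
  have T: "T \<subseteq> S \<times> UNIV \<times> S" using assms(1) by (auto simp: lts_def)
  have \<sigma>: "test_fv (\<sigma> X) = {}" "\<not> succeeds (\<sigma> X)" "test_acts (\<sigma> X) = {}" for X
    by (auto simp: \<sigma>_def elim: test_stepE)
  have "?t \<in> tests Act"
    using \<phi> to_test_fv[of \<phi> \<sigma>] to_test_acts[of \<sigma> \<phi>] \<sigma> by (auto simp: tests_def mustHML_def)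
  moreover have "sem S T \<phi> (\<lambda>_. {}) \<subseteq> {p \<in> S. will_succeed T (p, ?t)}"
    by (rule sem_subset_will_succeed) (use \<sigma> in auto)
  moreover have "{p \<in> S. (p, ?t) \<in> ?W} \<subseteq> sem S T \<phi> (\<lambda>_. {})"
  proof (rule winning_subset_sem[OF T])
    show "winning T ?W" by (auto simp: winning_def intro: will_succeed_open_step)
  qed (use \<sigma> in \<open>auto simp: \<sigma>_def not_will_succeed_TNil\<close>)
  ultimately show "\<exists>t :: ('a, 'v) test. t \<in> tests Act \<and> must_represents S T \<phi> t"
    unfolding must_represents_def must_satisfy_iff_will_succeed sem_closed_def by blast
qed

end
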